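(* Let $n \ge 2$ be an integer and let $\{x_0, x_1, \ldots, x_n\}$ be a set of $n+1$ distinct points of the Hamming cube $H_n$ (it is not assumed that $x_0$ is the zero vector). If the vectors $x_0, x_1, \ldots, x_n$ are affinely independent in $\mathbb{R}^n$, then \[ \det(D) = (-1)^n n 2^{n-1} V^2, \] where $V$ is the volume of the $n$-dimensional parallelepiped with sides $x_j - x_0$, $1 \le j \le n$.
   Context: $H_n$ is the set $\{0,1\}^n \subset \mathbb{R}^n$ with the metric $d(x,y) = \|x-y\|_1 = \sum_{k=1}^n |x_k - y_k|$. $D = (d(x_i,x_j))_{i,j=0}^n$ is the $(n+1)\times(n+1)$ distance matrix. The parallelepiped with sides $y_1,\dots,y_n \in \mathbb{R}^n$ is $\{t_1y_1+\cdots+t_ny_n : t_k\in[0,1],\ 1\le k\le n\}$. Differences $x_j - x_0$ are taken in $\mathbb{R}^n$. *)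

theory Defs
  imports "HOL-Analysis.Analysis" "Jordan_Normal_Form.Determinant"
begin

definition hamming_cube :: "(real ^ 'n::finite) set" where
  "hamming_cube = {v. \<forall>k. vec_nth v k \<in> {0, 1}}"

definition l1_dist :: "real ^ 'n::finite \<Rightarrow> real ^ 'n \<Rightarrow> real" where
  "l1_dist v w = (\<Sum>k\<in>UNIV. \<bar>vec_nth v k - vec_nth w k\<bar>)"

definition distance_matrix :: "nat \<Rightarrow> (nat \<Rightarrow> real ^ 'n::finite) \<Rightarrow> real Matrix.mat" where
  "distance_matrix n x = Matrix.mat (n + 1) (n + 1) (\<lambda>(i, j). l1_dist (x i) (x j))"

text \<open>Only the values \<open>y 1, \<dots>, y n\<close> matter; the value at index 0 is ignored.\<close>

definition parallelepiped :: "nat \<Rightarrow> (nat \<Rightarrow> real ^ 'n::finite) \<Rightarrow> (real ^ 'n) set" where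
  "parallelepiped n y = {(\<Sum>k = 1..n. t k *\<^sub>R y k) | t. \<forall>k\<in>{1..n}. t k \<in> {0..1}}"

end

theory Submission
  imports Defs
begin

text \<open>
  Put \<open>\<epsilon> = 1 - 2 x\<close>, a vector of signs.  For coordinates \<open>a, b\<close> in \<open>{0, 1}\<close> one has
  \<open>2 \<bar>a - b\<bar> = 1 - (1 - 2 a) (1 - 2 b)\<close>, so \<open>D = A G A\<^sup>T\<close>, where row \<open>i\<close> of the square matrix \<open>A\<close>
  is \<open>(1, \<epsilon>\<^sub>i)\<close> and \<open>G = diag (n/2, -1/2, \<dots>, -1/2)\<close>.  Subtracting the first row of \<open>A\<close>
  from the others gives \<open>det A = (-2)\<^sup>n det (x\<^sub>j - x\<^sub>0)\<close>.
\<close>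

no_notation Matrix.vec_index (infixl "$" 100)

section \<open>Volume of a parallelepiped as a determinant, for well-ordered index types\<close>

text \<open>Conjugation by \<open>e\<close> is a sign-preserving bijection between the two groups of
  permutations, so the two Leibniz sums agree term by term. This links the matrices indexed by
  numbers to the determinant that governs volumes in \<open>real ^ 'n\<close>.\<close>

lemma det_mat_eq_cart_det:
  fixes M :: "'n::finite \<Rightarrow> 'n \<Rightarrow> 'a::comm_ring_1"
  assumes e: "bij_betw e {0..<m} (UNIV :: 'n set)"
  shows "Determinant.det (Matrix.mat m m (\<lambda>(i, j). M (e i) (e j))) =
    Determinants.det (\<chi> i j. M i j)"
proof -
  let ?f = "map_permutation {0..<m} e"
  have inj: "inj_on e {0..<m}"
    using e by (rule bij_betw_imp_inj_on)
  have perms: "bij_betw ?f {p. p permutes {0..<m}} {p. p permutes (UNIV :: 'n set)}"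
    using bij_betw_permutations[OF e] bij_betw_imp_surj_on[OF e]
    by (simp add: map_permutation_def[abs_def] restrict_id_def o_def)
  have summand: "signof p * (\<Prod>i = 0..<m. M (e i) (e (p i))) =
      of_int (sign (?f p)) * (\<Prod>i\<in>UNIV. M i (?f p i))"
    if "p permutes {0..<m}" for p
  proof -
    have "(\<Prod>i\<in>UNIV. M i (?f p i)) = (\<Prod>i\<in>{0..<m}. M (e i) (?f p (e i)))"
      by (rule prod.reindex_bij_betw[OF e, symmetric])
    moreover have "sign (?f p) = sign p"
      using inj that by (simp add: sign_map_permutation)
    ultimately show ?thesis
      using inj by (simp add: map_permutation_apply)
  qed
  have "Determinant.det (Matrix.mat m m (\<lambda>(i, j). M (e i) (e j))) =
      (\<Sum>p | p permutes {0..<m}. signof p * (\<Prod>i = 0..<m. M (e i) (e (p i))))"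
    unfolding Determinant.det_def
    by (auto intro!: sum.cong prod.cong arg_cong2[of _ _ _ _ "(*)"] simp: permutes_in_image)
  also have "\<dots> = (\<Sum>p | p permutes {0..<m}.
      of_int (sign (?f p)) * (\<Prod>i\<in>UNIV. M i (?f p i)))"
    by (rule sum.cong) (auto simp: summand)
  also have "\<dots> = Determinants.det (\<chi> i j. M i j)"
    unfolding Determinants.det_def
    using sum.reindex_bij_betw[OF perms, of "\<lambda>q. of_int (sign q) * (\<Prod>i\<in>UNIV. M i (q i))"]
    by simp
  finally show ?thesis .
qed

text \<open>The parallelepiped is the image of the unit cube under the linear map whose columns are
  the sides. Compactness is recorded because it later supplies Borel measurability.\<close>

lemma measure_parallelepiped_wellorder:
  fixes y :: "nat \<Rightarrow> real ^ 'n::{finite,wellorder}"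
  assumes e: "bij_betw e {0..<n} (UNIV :: 'n set)"
  shows "compact (parallelepiped n y)"
    and "measure lebesgue (parallelepiped n y) =
    \<bar>Determinant.det (Matrix.mat n n (\<lambda>(i, j). y (Suc i) $ e j))\<bar>"
proof -
  define idx where "idx = inv_into {0..<n} e"
  \<comment> \<open>\<open>g\<close> assigns a side to each coordinate. The \<open>Suc\<close> is
    there because sides are numbered from 1 while \<open>e\<close> counts from 0.\<close>
  define g where "g = Suc \<circ> idx"
  have idx_e: "idx (e i) = i" if "i < n" for i
    using e that unfolding idx_def by (simp add: bij_betw_inv_into_left)
  have "bij_betw Suc {0..<n} {1..n}"
    by (auto simp: bij_betw_def image_Suc_atLeastLessThan atLeastLessThanSuc_atLeastAtMost)
  with bij_betw_inv_into[OF e] have g: "bij_betw g UNIV {1..n}"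
    unfolding g_def idx_def by (rule bij_betw_trans)
  define A where "A = (\<chi> i j. y (g j) $ i)"
  have A_apply: "A *v v = (\<Sum>j\<in>UNIV. (v $ j) *\<^sub>R y (g j))" for v
    by (simp add: A_def Finite_Cartesian_Product.vec_eq_iff matrix_vector_mult_def sum_component mult.commute)
  have image: "parallelepiped n y = (*v) A ` cbox 0 1"
  proof (intro equalityI subsetI)
    fix z assume "z \<in> parallelepiped n y"
    then obtain t where t: "\<forall>k\<in>{1..n}. t k \<in> {0..1}" and z: "z = (\<Sum>k = 1..n. t k *\<^sub>R y k)"
      unfolding parallelepiped_def by blast
    have "z = A *v (\<chi> j. t (g j))"
      unfolding z A_apply using sum.reindex_bij_betw[OF g, of "\<lambda>k. t k *\<^sub>R y k"] by simp
    moreover have "(\<chi> j. t (g j)) \<in> cbox 0 1"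
      using t g by (auto simp: mem_box_cart bij_betw_def)
    ultimately show "z \<in> (*v) A ` cbox 0 1" by blast
  next
    fix z assume "z \<in> (*v) A ` cbox 0 1"
    then obtain v where v: "v \<in> cbox 0 1" and z: "z = A *v v" by blast
    define t where "t k = v $ inv_into UNIV g k" for k
    have t_g: "t (g j) = v $ j" for j
      unfolding t_def using g by (simp add: bij_betw_def)
    have "z = (\<Sum>k = 1..n. t k *\<^sub>R y k)"
      unfolding z A_apply using sum.reindex_bij_betw[OF g, of "\<lambda>k. t k *\<^sub>R y k"]
      by (simp add: t_g)
    moreover have "\<forall>k\<in>{1..n}. t k \<in> {0..1}"
      using v by (simp add: t_def mem_box_cart)
    ultimately show "z \<in> parallelepiped n y"
      unfolding parallelepiped_def by blast
  qed
  show "compact (parallelepiped n y)"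
    unfolding image by (intro compact_continuous_image linear_continuous_on
        linear_conv_bounded_linear[THEN iffD1] matrix_vector_mul_linear compact_cbox)
  from image have "measure lebesgue (parallelepiped n y) =
      \<bar>Determinants.det A\<bar> * measure lebesgue (cbox (0 :: real ^ 'n::{finite,wellorder}) 1)"
    by (simp add: measure_linear_image)
  also have "measure lebesgue (cbox (0 :: real ^ 'n::{finite,wellorder}) 1) = 1"
    by (simp add: content_cbox_if_cart interval_eq_empty_cart)
  \<comment> \<open>The sides are the columns of \<open>A\<close> but the rows of the target matrix,
    hence the transposition.\<close>
  also have "Determinants.det A = Determinants.det (\<chi> i j. y (g i) $ j)"
    using Determinants.det_transpose[of A] by (simp add: A_def transpose_def)
  also have "\<dots> = Determinant.det (Matrix.mat n n (\<lambda>(i, j). y (g (e i)) $ e j))"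
    using det_mat_eq_cart_det[OF e, of "\<lambda>i j. y (g i) $ j"] by simp
  also have "Matrix.mat n n (\<lambda>(i, j). y (g (e i)) $ e j) =
      Matrix.mat n n (\<lambda>(i, j). y (Suc i) $ e j)"
    by (rule eq_matI) (auto simp: g_def idx_e)
  finally show "measure lebesgue (parallelepiped n y) =
      \<bar>Determinant.det (Matrix.mat n n (\<lambda>(i, j). y (Suc i) $ e j))\<bar>" by simp
qed

section \<open>Transfer to arbitrary finite index types\<close>

text \<open>The library's \<open>measure_linear_image\<close> needs a well-ordered index type, but the theorem allows any finite one.\<close>

typedef 'a wo_copy = "UNIV :: 'a set" ..

lemma bij_Abs_wo_copy: "bij Abs_wo_copy"
  by (rule bij_betw_byWitness[where f' = Rep_wo_copy])
    (auto simp: Abs_wo_copy_inverse Rep_wo_copy_inverse)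

instance wo_copy :: (finite) finite
proof
  show "finite (UNIV :: 'a::finite wo_copy set)"
    using bij_betw_finite[OF bij_Abs_wo_copy, where ?'a = 'a] by simp
qed

instantiation wo_copy :: (finite) wellorder
begin

text \<open>On a finite type this is an injection into the naturals. Pulling the order of
  \<open>nat\<close> back along it gives antisymmetry from injectivity and well-foundedness from
  measure induction.\<close>

definition rank_wo_copy :: "'a wo_copy \<Rightarrow> nat" where
  "rank_wo_copy = to_nat_on UNIV"

definition less_eq_wo_copy :: "'a wo_copy \<Rightarrow> 'a wo_copy \<Rightarrow> bool" where
  "x \<le> y \<longleftrightarrow> rank_wo_copy x \<le> rank_wo_copy y"

definition less_wo_copy :: "'a wo_copy \<Rightarrow> 'a wo_copy \<Rightarrow> bool" where
  "x < y \<longleftrightarrow> rank_wo_copy x < rank_wo_copy y"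

instance
proof
  have inj: "inj (rank_wo_copy :: 'a wo_copy \<Rightarrow> nat)"
    unfolding rank_wo_copy_def by (intro inj_on_to_nat_on countable_finite finite)
  fix x y z :: "'a wo_copy"
  show "x \<le> y \<Longrightarrow> y \<le> x \<Longrightarrow> x = y"
    using inj by (simp add: less_eq_wo_copy_def inj_eq)
next
  fix P :: "'a wo_copy \<Rightarrow> bool" and a
  assume "\<And>x. (\<And>y. y < x \<Longrightarrow> P y) \<Longrightarrow> P x"
  then show "P a"
    unfolding less_wo_copy_def by (rule measure_induct_rule)
qed (auto simp: less_eq_wo_copy_def less_wo_copy_def)

end

text \<open>Relabelling coordinates carries boxes to boxes with the same side lengths, and
  \<open>lborel\<close> is determined by its values on boxes.\<close>

lemma measure_lebesgue_reindex_cart: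
  fixes f :: "'m::finite \<Rightarrow> 'n::finite" and S :: "(real ^ 'n) set"
  assumes f: "bij f" and S: "S \<in> sets borel"
  shows "measure lebesgue ((\<lambda>v. \<chi> i. v $ f i) ` S) = measure lebesgue S"
proof -
  define g where "g = inv_into UNIV f"
  \<comment> \<open>\<open>k\<close> inverts the relabelling, so the image of \<open>S\<close> is
    the preimage of \<open>S\<close> under \<open>k\<close>, which is what \<open>distr\<close>
    measures.\<close>
  define k :: "real ^ 'm \<Rightarrow> real ^ 'n" where "k v = (\<chi> j. v $ g j)" for v
  have f_inv: "f (g j) = j" and inv_f: "g (f i) = i" for i j
    unfolding g_def using f by (simp_all add: bij_is_surj surj_f_inv_f bij_is_inj)
  have k: "k \<in> borel_measurable borel"
    unfolding k_def by (intro borel_measurable_continuous_onI continuous_intros)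
  have prod_Basis: "(\<Prod>b\<in>Basis. v \<bullet> b) = (\<Prod>i\<in>UNIV. v $ i)" for v :: "real ^ 'b::finite"
    by (simp add: Basis_vec_def cart_eq_inner_axis axis_eq_axis prod.UNION_disjoint)
  have "lborel = distr lborel borel k"
  proof (rule lborel_eqI)
    fix l u :: "real ^ 'n" assume le: "\<And>b. b \<in> Basis \<Longrightarrow> l \<bullet> b \<le> u \<bullet> b"
    then have le': "l $ i \<le> u $ i" for i
      by (simp add: cart_eq_inner_axis axis_in_Basis_iff)
    let ?l = "\<chi> i. l $ f i" and ?u = "\<chi> i. u $ f i"
    have "k -` box l u = box ?l ?u"
      unfolding k_def using f_inv inv_f by (auto simp: mem_box_cart) metis+
    then have "emeasure (distr lborel borel k) (box l u) = emeasure lborel (box ?l ?u)"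
      using k by (simp add: emeasure_distr)
    also have "\<dots> = (\<Prod>b\<in>Basis. (?u - ?l) \<bullet> b)"
      by (rule emeasure_lborel_box) (auto simp: Basis_vec_def inner_axis le')
    also have "(\<Prod>b\<in>Basis. (?u - ?l) \<bullet> b) = (\<Prod>b\<in>Basis. (u - l) \<bullet> b)"
      unfolding prod_Basis using prod.reindex_bij_betw[OF f, of "\<lambda>j. (u - l) $ j"] by simp
    finally show "emeasure (distr lborel borel k) (box l u) = (\<Prod>b\<in>Basis. (u - l) \<bullet> b)" .
  qed simp
  then have "measure lborel S = measure (distr lborel borel k) S"
    by (rule arg_cong)
  also have "\<dots> = measure lborel (k -` S)"
    using k S by (simp add: measure_distr)
  finally have "measure lborel S = measure lborel (k -` S)" .
  moreover have "(\<lambda>v. \<chi> i. v $ f i) ` S = k -` S"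
  proof (intro equalityI subsetI)
    fix v assume "v \<in> k -` S"
    moreover have "v = (\<chi> i. k v $ f i)"
      by (simp add: k_def Finite_Cartesian_Product.vec_eq_iff inv_f)
    ultimately show "v \<in> (\<lambda>v. \<chi> i. v $ f i) ` S" by blast
  qed (auto simp: k_def f_inv)
  moreover have "k -` S \<in> sets borel"
    using measurable_sets[OF k S] by simp
  ultimately show ?thesis
    using S by (simp add: measure_completion)
qed

text \<open>Relabelling is linear, so it maps the parallelepiped over \<open>'n wo_copy\<close> onto
  the given one, and it preserves volume.\<close>

lemma measure_parallelepiped:
  fixes y :: "nat \<Rightarrow> real ^ 'n::finite"
  assumes e: "bij_betw e {0..<n} (UNIV :: 'n set)"
  shows "measure lebesgue (parallelepiped n y) =
    \<bar>Determinant.det (Matrix.mat n n (\<lambda>(i, j). y (Suc i) $ e j))\<bar>"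
proof -
  define h :: "real ^ 'n wo_copy \<Rightarrow> real ^ 'n" where "h v = (\<chi> i. v $ Abs_wo_copy i)" for v
  define y' :: "nat \<Rightarrow> real ^ 'n wo_copy" where "y' k = (\<chi> i. y k $ Rep_wo_copy i)" for k
  have e': "bij_betw (Abs_wo_copy \<circ> e) {0..<n} UNIV"
    using e bij_Abs_wo_copy by (rule bij_betw_trans)
  have "h (\<Sum>k = 1..n. t k *\<^sub>R y' k) = (\<Sum>k = 1..n. t k *\<^sub>R y k)" for t
    by (simp add: h_def y'_def Finite_Cartesian_Product.vec_eq_iff sum_component Abs_wo_copy_inverse)
  then have "parallelepiped n y = h ` parallelepiped n y'"
    unfolding parallelepiped_def by (simp only: setcompr_eq_image image_image)
  also have "measure lebesgue \<dots> = measure lebesgue (parallelepiped n y')"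
    unfolding h_def using measure_parallelepiped_wellorder(1)[OF e']
    by (intro measure_lebesgue_reindex_cart bij_Abs_wo_copy borel_compact)
  also have "\<dots> = \<bar>Determinant.det (Matrix.mat n n (\<lambda>(i, j). y (Suc i) $ e j))\<bar>"
    unfolding measure_parallelepiped_wellorder(2)[OF e'] by (simp add: y'_def Abs_wo_copy_inverse)
  finally show ?thesis .
qed

section \<open>Determinant of the distance matrix\<close>

text \<open>Subtracting row 0 from all other rows clears the column of ones below the corner. In the
  factorization \<open>L * B\<close>, \<open>B\<close> is the reduced matrix and the unitriangular
  \<open>L\<close> adds row 0 back.\<close>

lemma det_border_ones:
  fixes w :: "nat \<Rightarrow> nat \<Rightarrow> 'a::idom"
  shows "Determinant.det (Matrix.mat (Suc n) (Suc n) (\<lambda>(i, j). if j = 0 then 1 else w i (j - 1))) =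
    Determinant.det (Matrix.mat n n (\<lambda>(i, j). w (Suc i) j - w 0 j))"
proof -
  let ?A = "Matrix.mat (Suc n) (Suc n) (\<lambda>(i, j). if j = 0 then 1 else w i (j - 1))"
  let ?Y = "Matrix.mat n n (\<lambda>(i, j). w (Suc i) j - w 0 j)"
  define L :: "'a Matrix.mat" where
    "L = Matrix.mat (Suc n) (Suc n) (\<lambda>(i, j). if j = 0 \<or> i = j then 1 else 0)"
  define B where
    "B = four_block_mat (1\<^sub>m 1) (Matrix.mat 1 n (\<lambda>(i, j). w 0 j)) (0\<^sub>m n 1) ?Y"
  have L: "L \<in> carrier_mat (Suc n) (Suc n)" and B: "B \<in> carrier_mat (Suc n) (Suc n)"
    by (auto simp: L_def B_def)
  have "?A = L * B"
  proof (rule eq_matI)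
    fix i j assume "i < dim_row (L * B)" "j < dim_col (L * B)"
    then have ij: "i < Suc n" "j < Suc n"
      using L B by auto
    have "(L * B) $$ (i, j) = (\<Sum>k = 0..<Suc n. L $$ (i, k) * B $$ (k, j))"
      using L B ij by (simp add: scalar_prod_def)
    \<comment> \<open>Row \<open>i\<close> of \<open>L\<close> vanishes outside columns 0 and
      \<open>i\<close>. These coincide when \<open>i = 0\<close>, which forces the case split
      below.\<close>
    also have "\<dots> = (\<Sum>k \<in> {0, i}. L $$ (i, k) * B $$ (k, j))"
      using ij by (intro sum.mono_neutral_right) (auto simp: L_def)
    also have "\<dots> = ?A $$ (i, j)"
      using ij by (cases "i = 0"; cases "j = 0") (auto simp: L_def B_def)
    finally show "?A $$ (i, j) = (L * B) $$ (i, j)" ..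
  qed (use L B in auto)
  moreover have "Determinant.det L = 1"
  proof -
    have "Determinant.det L = prod_list (diag_mat L)"
      by (rule det_lower_triangular[OF _ L]) (auto simp: L_def)
    also have "\<dots> = 1"
      unfolding prod_list_diag_prod by (simp add: L_def)
    finally show ?thesis .
  qed
  moreover have "Determinant.det B = Determinant.det ?Y"
    unfolding B_def by (subst det_four_block_mat_lower_left_zero_col) auto
  ultimately show ?thesis
    using Determinant.det_mult[OF L B] by simp
qed

lemma abs_diff_zero_one:
  fixes a b :: real
  assumes "a \<in> {0, 1}" "b \<in> {0, 1}"
  shows "\<bar>a - b\<bar> = (1 - (1 - 2 * a) * (1 - 2 * b)) / 2"
  using assms by auto

text \<open>In the product formula for \<open>A * G * transpose_mat A\<close>, the first two factors
  form \<open>det G\<close> and the squared factor is \<open>det A\<close>.\<close>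

lemma det_distance_matrix:
  fixes x :: "nat \<Rightarrow> real ^ 'n::finite"
  assumes e: "bij_betw e {0..<n} (UNIV :: 'n set)"
    and cube: "\<And>i. i \<le> n \<Longrightarrow> x i \<in> hamming_cube"
  shows "Determinant.det (distance_matrix n x) = (real n / 2) * (- 1 / 2) ^ n *
    ((- 2) ^ n * Determinant.det (Matrix.mat n n (\<lambda>(i, j). (x (Suc i) - x 0) $ e j)))\<^sup>2"
proof -
  define w where "w i j = 1 - 2 * x i $ e j" for i j
  define A where "A = Matrix.mat (Suc n) (Suc n) (\<lambda>(i, j). if j = 0 then 1 else w i (j - 1))"
  define d where "d k = (if k = 0 then real n / 2 else - 1 / 2)" for k :: nat
  define G where "G = Matrix.mat (Suc n) (Suc n) (\<lambda>(i, j). if i = j then d i else 0)"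
  let ?Y = "Matrix.mat n n (\<lambda>(i, j). (x (Suc i) - x 0) $ e j)"
  have A: "A \<in> carrier_mat (Suc n) (Suc n)" and G: "G \<in> carrier_mat (Suc n) (Suc n)"
    and AG: "A * G \<in> carrier_mat (Suc n) (Suc n)"
    by (auto simp: A_def G_def)
  have AG_index: "(A * G) $$ (i, k) = A $$ (i, k) * d k" if "i < Suc n" "k < Suc n" for i k
  proof -
    have "(A * G) $$ (i, k) = (\<Sum>l = 0..<Suc n. A $$ (i, l) * G $$ (l, k))"
      using A G that by (simp add: scalar_prod_def)
    also have "\<dots> = (\<Sum>l \<in> {k}. A $$ (i, l) * G $$ (l, k))"
      using that by (intro sum.mono_neutral_right) (auto simp: G_def)
    finally show ?thesis
      using that by (simp add: G_def)
  qed
  have "distance_matrix n x = A * G * transpose_mat A"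
  proof (rule eq_matI)
    fix i j assume "i < dim_row (A * G * transpose_mat A)" "j < dim_col (A * G * transpose_mat A)"
    then have ij: "i < Suc n" "j < Suc n"
      using A by auto
    have "(A * G * transpose_mat A) $$ (i, j) = (\<Sum>k = 0..<Suc n. (A * G) $$ (i, k) * A $$ (j, k))"
      using A AG ij by (subst index_mult_mat) (auto simp: scalar_prod_def intro!: sum.cong)
    also have "\<dots> = (\<Sum>k = 0..<Suc n. A $$ (i, k) * d k * A $$ (j, k))"
      using ij by (intro sum.cong) (auto simp: AG_index)
    also have "\<dots> = real n / 2 + (\<Sum>k = 0..<n. - 1 / 2 * (w i k * w j k))"
      using ij by (subst sum.atLeast0_lessThan_Suc_shift) (simp add: A_def d_def mult.commute)
    \<comment> \<open>The weight \<open>n / 2\<close> of the constant column is spread as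
      \<open>1 / 2\<close> over the \<open>n\<close> coordinates, so that each summand becomes one
      coordinate distance.\<close>
    also have "\<dots> = (\<Sum>k = 0..<n. (1 - w i k * w j k) / 2)"
      by (simp add: sum_subtractf diff_divide_distrib sum_negf)
    also have "\<dots> = (\<Sum>k = 0..<n. \<bar>x i $ e k - x j $ e k\<bar>)"
      using cube[of i] cube[of j] ij
      by (intro sum.cong refl) (simp add: w_def abs_diff_zero_one hamming_cube_def)
    also have "\<dots> = l1_dist (x i) (x j)"
      unfolding l1_dist_def by (rule sum.reindex_bij_betw[OF e])
    finally show "distance_matrix n x $$ (i, j) = (A * G * transpose_mat A) $$ (i, j)"
      using ij by (simp add: distance_matrix_def)
  qed (use A in \<open>auto simp: distance_matrix_def\<close>)
  then have "Determinant.det (distance_matrix n x) = Determinant.det G * (Determinant.det A)\<^sup>2"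
    using A by (simp add: Determinant.det_mult[OF AG] Determinant.det_mult[OF A G]
        Determinant.det_transpose[OF A] power2_eq_square)
  also have "Determinant.det G = (real n / 2) * (- 1 / 2) ^ n"
  proof -
    have "Determinant.det G = prod_list (diag_mat G)"
      by (rule det_lower_triangular[OF _ G]) (auto simp: G_def)
    also have "\<dots> = (\<Prod>i = 0..<Suc n. d i)"
      unfolding prod_list_diag_prod by (simp add: G_def)
    also have "\<dots> = (real n / 2) * (- 1 / 2) ^ n"
      by (subst prod.atLeast0_lessThan_Suc_shift) (simp add: d_def)
    finally show ?thesis .
  qed
  also have "Determinant.det A = (- 2) ^ n * Determinant.det ?Y"
  proof -
    \<comment> \<open>The constant 1 in \<open>w\<close> cancels in differences of rows, leaving the
      factor \<open>- 2\<close> in each of the \<open>n\<close> rows.\<close>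
    have "Matrix.mat n n (\<lambda>(i, j). w (Suc i) j - w 0 j) = (- 2) \<cdot>\<^sub>m ?Y"
      by (rule eq_matI) (auto simp: w_def)
    then show ?thesis
      unfolding A_def by (simp add: det_border_ones)
  qed
  finally show ?thesis .
qed

theorem corollary2p8:
  fixes n :: nat and x :: "nat \<Rightarrow> real ^ 'n::finite"
  assumes "CARD('n) = n" and "n \<ge> 2"
    and "\<And>i. i \<le> n \<Longrightarrow> x i \<in> hamming_cube"
    and "inj_on x {0..n}"
    and "\<not> affine_dependent (x ` {0..n})"
  shows "Determinant.det (distance_matrix n x) =
    (-1) ^ n * real n * 2 ^ (n - 1) *
      (measure lebesgue (parallelepiped n (\<lambda>j. x j - x 0)))\<^sup>2"
proof -
  obtain e where e: "bij_betw e {0..<n} (UNIV :: 'n set)"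
    using ex_bij_betw_nat_finite[of "UNIV :: 'n set"] assms(1) by auto
  let ?d = "Determinant.det (Matrix.mat n n (\<lambda>(i, j). (x (Suc i) - x 0) $ e j))"
  have "Determinant.det (distance_matrix n x) = (real n / 2) * (- 1 / 2) ^ n * ((- 2) ^ n * ?d)\<^sup>2"
    using e assms(3) by (rule det_distance_matrix)
  \<comment> \<open>One of the two factors \<open>(- 2) ^ n\<close> is set aside to cancel
    \<open>(- 1 / 2) ^ n\<close>. The other one, halved, yields the sign and the power of 2.\<close>
  also have "(real n / 2) * (- 1 / 2) ^ n * ((- 2) ^ n * ?d)\<^sup>2 =
      real n * ((- 1 / 2) ^ n * (- 2) ^ n) * ((- 2) ^ n / 2) * ?d\<^sup>2"
    by (simp add: power2_eq_square)
  also have "(- 1 / 2) ^ n * (- 2) ^ n = (1 :: real)"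
    by (simp flip: power_mult_distrib)
  also have "(- 2) ^ n / 2 = (- 1) ^ n * (2 :: real) ^ (n - 1)"
    using assms(2) by (cases n) (auto simp: power_minus[of 2])
  \<comment> \<open>Squaring removes the absolute value, so neither the orientation of the sides nor
    the choice of \<open>e\<close> matters.\<close>
  also have "?d\<^sup>2 = (measure lebesgue (parallelepiped n (\<lambda>j. x j - x 0)))\<^sup>2"
    unfolding measure_parallelepiped[OF e] by simp
  finally show ?thesis
    by (simp only: mult_ac mult_1)
qed

end
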